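(* Let $G$ be a real Lie group of dimension $n\ge 3$ with Lie algebra $\mathfrak g$ whose derived algebra $\mathfrak g'=[\mathfrak g,\mathfrak g]$ is two-dimensional, and let $(J,g)$ be a left-invariant almost Hermitian structure on $G$ of Type I, i.e. $J(\mathfrak g')=\mathfrak g'$. Let $\{\mathsf e_1,\mathsf e_2\}$ be an orthonormal basis of $\mathfrak g'$ with $J\mathsf e_1=\mathsf e_2$, let $\Gamma=(\mathfrak g')^{\perp}$, and let $\mathsf a_1,\mathsf a_2,\mathsf b_1,\mathsf b_2\in\Gamma$ and the skew-adjoint maps $f_1,f_2:\Gamma\to\Gamma$ be the structure data of $\mathfrak g$ with respect to this basis (defined in the context). Then $(J,g)$ is Hermitian (i.e. $J$ is integrable) if and only if the following two equations hold, the first in $\Gamma$ and the second as an identity of linear maps $\Gamma\to\Gamma$ (where $J$ stands for $J|_\Gamma$): $$\mathsf b_2-\mathsf a_1=J(\mathsf a_2+\mathsf b_1),$$ $$Jf_1-f_1J=Jf_2J+f_2.$$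
   Context: Left-invariant structures are identified with their values on $\mathfrak g$: $g$ corresponds to an inner product $\langle\cdot,\cdot\rangle$ on $\mathfrak g$, and $J$ to a linear map $J:\mathfrak g\to\mathfrak g$ with $J^2=-\mathrm{Id}$. The pair $(J,g)$ is almost Hermitian if $\langle Jx,Jy\rangle=\langle x,y\rangle$ for all $x,y\in\mathfrak g$. It is Hermitian if in addition $J$ is integrable, i.e. $N_J(x,y)=[x,y]+J([Jx,y]+[x,Jy])-[Jx,Jy]=0$ for all $x,y\in\mathfrak g$. Structure data. If $\dim\mathfrak g'=2$ then $\mathfrak g$ is solvable and $\mathfrak g'$ is abelian. Let $\{\mathsf e_1,\mathsf e_2\}$ be an orthonormal basis of $\mathfrak g'$ and $\Gamma$ the orthogonal complement of $\mathfrak g'$ in $\mathfrak g$. There are unique vectors $\mathsf a_1,\mathsf a_2,\mathsf b_1,\mathsf b_2\in\Gamma$ and unique skew-adjoint linear maps $f_1,f_2:\Gamma\to\Gamma$ such that for all $u,v\in\Gamma$ $$[u,\mathsf e_1]=\langle\mathsf a_1,u\rangle\mathsf e_1+\langle\mathsf a_2,u\rangle\mathsf e_2,\qquad [u,\mathsf e_2]=\langle\mathsf b_1,u\rangle\mathsf e_1+\langle\mathsf b_2,u\rangle\mathsf e_2,$$ $$[u,v]=\langle f_1(u),v\rangle\mathsf e_1+\langle f_2(u),v\rangle\mathsf e_2.$$ An almost Hermitian structure is of Type I if $J(\mathfrak g')=\mathfrak g'$; then $J(\Gamma)=\Gamma$. *)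

theory Defs
  imports "HOL-Analysis.Analysis"
begin

text \<open>
  Left-invariant structures on a real Lie group are represented by their values on its Lie algebra.
  The Lie algebra is carried by a Euclidean space type, whose inner product is the
  left-invariant metric; the Lie bracket and the almost complex structure are explicit maps.
\<close>

definition lie_bracket :: "('a::real_vector \<Rightarrow> 'a \<Rightarrow> 'a) \<Rightarrow> bool" where
  "lie_bracket br \<longleftrightarrow>
     (\<forall>x. linear (\<lambda>y. br x y)) \<and> (\<forall>y. linear (\<lambda>x. br x y)) \<and>
     (\<forall>x. br x x = 0) \<and>
     (\<forall>x y z. br x (br y z) + br y (br z x) + br z (br x y) = 0)"

definition derived_algebra :: "('a::real_vector \<Rightarrow> 'a \<Rightarrow> 'a) \<Rightarrow> 'a set" where
  "derived_algebra br = span {br x y | x y. True}"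

definition almost_hermitian :: "('a::real_inner \<Rightarrow> 'a) \<Rightarrow> bool" where
  "almost_hermitian J \<longleftrightarrow>
     linear J \<and> (\<forall>x. J (J x) = - x) \<and> (\<forall>x y. J x \<bullet> J y = x \<bullet> y)"

definition nijenhuis ::
  "('a::real_vector \<Rightarrow> 'a \<Rightarrow> 'a) \<Rightarrow> ('a \<Rightarrow> 'a) \<Rightarrow> 'a \<Rightarrow> 'a \<Rightarrow> 'a" where
  "nijenhuis br J x y = br x y + J (br (J x) y + br x (J y)) - br (J x) (J y)"

definition integrable_structure ::
  "('a::real_vector \<Rightarrow> 'a \<Rightarrow> 'a) \<Rightarrow> ('a \<Rightarrow> 'a) \<Rightarrow> bool" where
  "integrable_structure br J \<longleftrightarrow> (\<forall>x y. nijenhuis br J x y = 0)"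

definition hermitian ::
  "('a::real_inner \<Rightarrow> 'a \<Rightarrow> 'a) \<Rightarrow> ('a \<Rightarrow> 'a) \<Rightarrow> bool" where
  "hermitian br J \<longleftrightarrow> almost_hermitian J \<and> integrable_structure br J"

definition type_I ::
  "('a::real_inner \<Rightarrow> 'a \<Rightarrow> 'a) \<Rightarrow> ('a \<Rightarrow> 'a) \<Rightarrow> bool" where
  "type_I br J \<longleftrightarrow> J ` derived_algebra br = derived_algebra br"

definition orthonormal_basis2 :: "'a::real_inner set \<Rightarrow> 'a \<Rightarrow> 'a \<Rightarrow> bool" where
  "orthonormal_basis2 V e1 e2 \<longleftrightarrow>
     norm e1 = 1 \<and> norm e2 = 1 \<and> orthogonal e1 e2 \<and> span {e1, e2} = V"

text \<open>
  An endomorphism of a subspace is a total function whose values outside the subspace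
  are irrelevant.
\<close>

definition skew_adjoint_on :: "'a::real_inner set \<Rightarrow> ('a \<Rightarrow> 'a) \<Rightarrow> bool" where
  "skew_adjoint_on S f \<longleftrightarrow>
     (\<forall>u\<in>S. f u \<in> S) \<and>
     (\<forall>u\<in>S. \<forall>v\<in>S. f (u + v) = f u + f v) \<and>
     (\<forall>c. \<forall>u\<in>S. f (c *\<^sub>R u) = c *\<^sub>R f u) \<and>
     (\<forall>u\<in>S. \<forall>v\<in>S. f u \<bullet> v = - (u \<bullet> f v))"

definition structure_data ::
  "('a::real_inner \<Rightarrow> 'a \<Rightarrow> 'a) \<Rightarrow> 'a \<Rightarrow> 'a \<Rightarrow> 'a \<Rightarrow> 'a \<Rightarrow> 'a \<Rightarrow> 'a \<Rightarrow>
    ('a \<Rightarrow> 'a) \<Rightarrow> ('a \<Rightarrow> 'a) \<Rightarrow> bool" where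
  "structure_data br e1 e2 a1 a2 b1 b2 f1 f2 \<longleftrightarrow>
     (let \<Gamma> = (derived_algebra br)\<^sup>\<bottom> in
       a1 \<in> \<Gamma> \<and> a2 \<in> \<Gamma> \<and> b1 \<in> \<Gamma> \<and> b2 \<in> \<Gamma> \<and>
       skew_adjoint_on \<Gamma> f1 \<and> skew_adjoint_on \<Gamma> f2 \<and>
       (\<forall>u\<in>\<Gamma>. br u e1 = (a1 \<bullet> u) *\<^sub>R e1 + (a2 \<bullet> u) *\<^sub>R e2) \<and>
       (\<forall>u\<in>\<Gamma>. br u e2 = (b1 \<bullet> u) *\<^sub>R e1 + (b2 \<bullet> u) *\<^sub>R e2) \<and>
       (\<forall>u\<in>\<Gamma>. \<forall>v\<in>\<Gamma>. br u v = (f1 u \<bullet> v) *\<^sub>R e1 + (f2 u \<bullet> v) *\<^sub>R e2))"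

end

theory Submission
  imports Defs
begin

text \<open>
  The Nijenhuis tensor is bilinear, alternating and satisfies \<open>N x (J y) = - J (N x y)\<close>. Since
  \<open>J e1 = e2\<close>, it vanishes on the derived algebra, and on the whole algebra as soon as
  \<open>N u e1 = 0\<close> and \<open>N u v = 0\<close> for \<open>u, v\<close> in the orthogonal complement \<open>\<Gamma>\<close>. Both values lie in the
  span of \<open>e1, e2\<close>, and their coordinates are inner products of \<open>u\<close> or \<open>v\<close> with the vector
  measuring the failure of the corresponding equation, or with its image under \<open>J\<close>.
\<close>

section \<open>Bilinearity and symmetries of the Nijenhuis tensor\<close>

lemma nijenhuis_add_right:
  assumes "lie_bracket br" "linear J"
  shows "nijenhuis br J x (y + z) = nijenhuis br J x y + nijenhuis br J x z"
proof -
  have "br w (p + q) = br w p + br w q" for w p q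
    using assms(1) by (simp add: lie_bracket_def linear_add)
  then show ?thesis
    by (simp add: nijenhuis_def linear_add[OF assms(2)])
qed

lemma nijenhuis_scaleR_right:
  assumes "lie_bracket br" "linear J"
  shows "nijenhuis br J x (c *\<^sub>R y) = c *\<^sub>R nijenhuis br J x y"
proof -
  have "br w (c *\<^sub>R p) = c *\<^sub>R br w p" for w p
    using assms(1) by (simp add: lie_bracket_def linear_scale)
  then show ?thesis
    by (simp add: nijenhuis_def linear_add[OF assms(2)] linear_scale[OF assms(2)] algebra_simps)
qed

lemma lie_bracket_skew:
  assumes "lie_bracket br"
  shows "br x y = - br y x"
proof -
  have l: "br (p + q) w = br p w + br q w" for w p q
  proof -
    have "linear (\<lambda>x. br x w)"
      using assms by (simp add: lie_bracket_def)
    from linear_add[OF this] show ?thesis .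
  qed
  have r: "br w (p + q) = br w p + br w q" for w p q
    using assms by (simp add: lie_bracket_def linear_add)
  have z: "br w w = 0" for w
    using assms by (simp add: lie_bracket_def)
  have "br x y + br y x = 0"
    using z[of "x + y"] z[of x] z[of y] by (simp add: l r add.commute)
  then show ?thesis
    by (simp add: eq_neg_iff_add_eq_0)
qed

lemma nijenhuis_skew:
  assumes "lie_bracket br" "linear J"
  shows "nijenhuis br J x y = - nijenhuis br J y x"
proof -
  \<comment> \<open>The signs under \<open>J\<close> are kept as a single outer minus, which
    linearity of \<open>J\<close> then pulls out.\<close>
  have "nijenhuis br J x y = - br y x + J (- (br (J y) x + br y (J x))) + br (J y) (J x)"
    using lie_bracket_skew[OF assms(1), of x y] lie_bracket_skew[OF assms(1), of "J x" y]
      lie_bracket_skew[OF assms(1), of x "J y"] lie_bracket_skew[OF assms(1), of "J x" "J y"]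
    by (simp add: nijenhuis_def algebra_simps)
  then show ?thesis
    by (simp add: nijenhuis_def linear_neg[OF assms(2)] del: minus_add_distrib)
qed

text \<open>Since \<open>J\<close> squares to minus the identity, passing from \<open>y\<close> to
  \<open>J y\<close> permutes the four terms: those outside \<open>J\<close> move inside and
  conversely.\<close>

lemma nijenhuis_J_right:
  assumes br: "lie_bracket br" and J: "linear J" "\<And>x. J (J x) = - x"
  shows "nijenhuis br J x (J y) = - J (nijenhuis br J x y)"
proof -
  have "br w (- p) = - br w p" for w p
    using br by (simp add: lie_bracket_def linear_neg)
  then show ?thesis
    by (simp add: nijenhuis_def J linear_add[OF J(1)] linear_diff[OF J(1)] linear_neg[OF J(1)])
qed

lemma nijenhuis_add_left:
  assumes "lie_bracket br" "linear J"
  shows "nijenhuis br J (x + y) z = nijenhuis br J x z + nijenhuis br J y z"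
  using nijenhuis_add_right[OF assms, of z x y] nijenhuis_skew[OF assms, of "x + y" z]
    nijenhuis_skew[OF assms, of x z] nijenhuis_skew[OF assms, of y z]
  by simp

lemma nijenhuis_scaleR_left:
  assumes "lie_bracket br" "linear J"
  shows "nijenhuis br J (c *\<^sub>R x) z = c *\<^sub>R nijenhuis br J x z"
  using nijenhuis_scaleR_right[OF assms, of z c x] nijenhuis_skew[OF assms, of "c *\<^sub>R x" z]
    nijenhuis_skew[OF assms, of x z]
  by simp

lemma nijenhuis_self:
  assumes "lie_bracket br" "linear J"
  shows "nijenhuis br J x x = 0"
proof -
  have "br y y = 0" for y
    using assms(1) by (simp add: lie_bracket_def)
  moreover have "br (J x) x + br x (J x) = 0"
    using lie_bracket_skew[OF assms(1), of "J x" x] by simp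
  ultimately show ?thesis
    by (simp add: nijenhuis_def linear_0[OF assms(2)])
qed

section \<open>Orthogonal splitting and its compatibility with \<open>J\<close>\<close>

lemma almost_hermitian_inner_J:
  assumes "almost_hermitian J"
  shows "x \<bullet> J y = - (J x \<bullet> y)"
proof -
  \<comment> \<open>Apply the isometry \<open>J\<close> to both factors;
    \<open>J (J y) = - y\<close> then makes \<open>J\<close> skew-adjoint. Used as a rewrite rule,
    this moves every \<open>J\<close> to the first factor.\<close>
  have "x \<bullet> J y = J x \<bullet> J (J y)"
    using assms unfolding almost_hermitian_def by metis
  then show ?thesis
    using assms by (simp add: almost_hermitian_def)
qed

text \<open>A skew-adjoint map that preserves a set also preserves its orthogonal complement. For
  Type I structures this gives the action of \<open>J\<close> on \<Gamma>, so the structure data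
  also apply to \<open>J u\<close>.\<close>

lemma almost_hermitian_orthogonal_comp:
  assumes J: "almost_hermitian J" and V: "J ` V = V" and u: "u \<in> V\<^sup>\<bottom>"
  shows "J u \<in> V\<^sup>\<bottom>"
proof -
  have "y \<bullet> J u = 0" if "y \<in> V" for y
  proof -
    have "J y \<in> V"
      using V that by blast
    then have "J y \<bullet> u = 0"
      using u by (simp add: orthogonal_comp_def orthogonal_def)
    then show ?thesis
      by (simp add: almost_hermitian_inner_J[OF J])
  qed
  then show ?thesis
    by (simp add: orthogonal_comp_def orthogonal_def)
qed

lemma orthonormal_basis2_decompose:
  assumes "orthonormal_basis2 V e1 e2"
  obtains p q u where "x = p *\<^sub>R e1 + q *\<^sub>R e2 + u" "u \<in> V\<^sup>\<bottom>"
proof -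
  define u where "u = x - (x \<bullet> e1) *\<^sub>R e1 - (x \<bullet> e2) *\<^sub>R e2"
  have e: "e1 \<bullet> e1 = 1" "e2 \<bullet> e2 = 1" "e1 \<bullet> e2 = 0" "e2 \<bullet> e1 = 0" and V: "V = span {e1, e2}"
    using assms
    by (auto simp: orthonormal_basis2_def norm_eq_1 orthogonal_def inner_commute)
  have u_e: "orthogonal u e1" "orthogonal u e2"
    by (simp_all add: u_def orthogonal_def inner_diff_left e)
  have "orthogonal u y" if "y \<in> V" for y
    using that u_e unfolding V by (intro orthogonal_to_span[of y "{e1, e2}"]) auto
  then have "u \<in> V\<^sup>\<bottom>"
    by (simp add: orthogonal_comp_def orthogonal_commute)
  moreover have "x = (x \<bullet> e1) *\<^sub>R e1 + (x \<bullet> e2) *\<^sub>R e2 + u"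
    by (simp add: u_def)
  ultimately show ?thesis
    using that by blast
qed

lemma orthonormal_combination_eq_0_iff:
  fixes e1 e2 :: "'a::real_inner"
  assumes "orthonormal_basis2 V e1 e2"
  shows "p *\<^sub>R e1 + q *\<^sub>R e2 = 0 \<longleftrightarrow> p = 0 \<and> q = 0"
proof
  assume 0: "p *\<^sub>R e1 + q *\<^sub>R e2 = 0"
  have e: "e1 \<bullet> e1 = 1" "e2 \<bullet> e2 = 1" "e1 \<bullet> e2 = 0" "e2 \<bullet> e1 = 0"
    using assms
    by (auto simp: orthonormal_basis2_def norm_eq_1 orthogonal_def inner_commute)
  have "(p *\<^sub>R e1 + q *\<^sub>R e2) \<bullet> e1 = p" "(p *\<^sub>R e1 + q *\<^sub>R e2) \<bullet> e2 = q"
    by (simp_all add: inner_add_left e)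
  then show "p = 0 \<and> q = 0"
    unfolding 0 by simp
qed simp

section \<open>Reduction of integrability to pairs involving the complement\<close>

lemma nijenhuis_vanishes_iff:
  assumes br: "lie_bracket br" and J: "linear J" "\<And>x. J (J x) = - x"
    and V: "orthonormal_basis2 V e1 e2" and e2: "J e1 = e2"
  shows "(\<forall>x y. nijenhuis br J x y = 0) \<longleftrightarrow>
    (\<forall>u\<in>V\<^sup>\<bottom>. nijenhuis br J u e1 = 0) \<and> (\<forall>u\<in>V\<^sup>\<bottom>. \<forall>v\<in>V\<^sup>\<bottom>. nijenhuis br J u v = 0)"
    (is "_ \<longleftrightarrow> ?R")
proof
  assume R: ?R
  note skew = nijenhuis_skew[OF br J(1)]
  have J0: "J 0 = 0"
    using linear_0[OF J(1)] .
  have ee: "nijenhuis br J x x = 0" for x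
    by (rule nijenhuis_self[OF br J(1)])
  \<comment> \<open>Because \<open>e2 = J e1\<close>, values against \<open>e2\<close> are
    determined by those against \<open>e1\<close>. In particular the pair \<open>e1, e2\<close>
    reduces to the diagonal value at \<open>e1\<close>.\<close>
  have right_e2: "nijenhuis br J x e2 = - J (nijenhuis br J x e1)" for x
    using nijenhuis_J_right[OF br J, of x e1] by (simp add: e2)
  have e12: "nijenhuis br J e1 e2 = 0"
    by (simp add: right_e2 ee J0)
  have e21: "nijenhuis br J e2 e1 = 0"
    using skew[of e2 e1] e12 by simp
  have ue: "nijenhuis br J u e1 = 0" "nijenhuis br J u e2 = 0"
    "nijenhuis br J e1 u = 0" "nijenhuis br J e2 u = 0" if "u \<in> V\<^sup>\<bottom>" for u
    using R that skew[of e1 u] skew[of e2 u] by (simp_all add: right_e2 J0)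
  show "\<forall>x y. nijenhuis br J x y = 0"
  proof (intro allI)
    fix x y
    obtain p q u where x: "x = p *\<^sub>R e1 + q *\<^sub>R e2 + u" "u \<in> V\<^sup>\<bottom>"
      using orthonormal_basis2_decompose[OF V] .
    obtain r s v where y: "y = r *\<^sub>R e1 + s *\<^sub>R e2 + v" "v \<in> V\<^sup>\<bottom>"
      using orthonormal_basis2_decompose[OF V] .
    show "nijenhuis br J x y = 0"
      \<comment> \<open>Bilinear expansion gives nine terms, and each of them is already known to
        vanish.\<close>
      using R x(2) y(2) ue e12 e21 ee unfolding x(1) y(1)
      by (simp add: nijenhuis_add_right[OF br J(1)] nijenhuis_add_left[OF br J(1)]
          nijenhuis_scaleR_right[OF br J(1)] nijenhuis_scaleR_left[OF br J(1)])
  qed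
qed simp

text \<open>The vector \<open>p\<close> is the defect of the first equation. The \<open>e2\<close>
  coordinate is \<open>p \<bullet> J u\<close>, as forced by
  \<open>N (J u) e1 = - J (N u e1)\<close>; skew-adjointness of \<open>J\<close> turns it into
  \<open>- (J p \<bullet> u)\<close>.\<close>

lemma nijenhuis_e1:
  assumes J: "almost_hermitian J" and \<Gamma>: "type_I br J"
    and e2: "J e1 = e2"
    and sd: "structure_data br e1 e2 a1 a2 b1 b2 f1 f2"
    and u: "u \<in> (derived_algebra br)\<^sup>\<bottom>"
  defines "p \<equiv> a1 - b2 + J (a2 + b1)"
  shows "nijenhuis br J u e1 = (p \<bullet> u) *\<^sub>R e1 + (- (J p \<bullet> u)) *\<^sub>R e2"
proof -
  have lin: "linear J" and JJ: "\<And>x. J (J x) = - x"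
    using J by (auto simp: almost_hermitian_def)
  have Ju: "J u \<in> (derived_algebra br)\<^sup>\<bottom>"
    using almost_hermitian_orthogonal_comp[OF J _ u] \<Gamma> by (simp add: type_I_def)
  have Je2: "J e2 = - e1"
    using JJ[of e1] by (simp add: e2)
  have br: "br w e1 = (a1 \<bullet> w) *\<^sub>R e1 + (a2 \<bullet> w) *\<^sub>R e2"
    "br w e2 = (b1 \<bullet> w) *\<^sub>R e1 + (b2 \<bullet> w) *\<^sub>R e2" if "w \<in> (derived_algebra br)\<^sup>\<bottom>" for w
    using sd that by (simp_all add: structure_data_def Let_def)
  show ?thesis
    unfolding nijenhuis_def e2 br[OF u] br[OF Ju] p_def
    by (simp add: linear_add[OF lin] linear_diff[OF lin] linear_scale[OF lin] e2 Je2 JJ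
        almost_hermitian_inner_J[OF J] inner_add_left inner_diff_left algebra_simps)
qed

text \<open>Here \<open>q\<close> is the defect of the second equation at \<open>u\<close>.
  Collecting the \<open>e2\<close> coordinates and moving \<open>J\<close> off \<open>v\<close>
  gives \<open>- (q \<bullet> v)\<close>; the \<open>e1\<close> coordinates give the same expression
  with \<open>J q\<close> in place of \<open>q\<close>.\<close>

lemma nijenhuis_complement:
  assumes J: "almost_hermitian J" and \<Gamma>: "type_I br J"
    and e2: "J e1 = e2"
    and sd: "structure_data br e1 e2 a1 a2 b1 b2 f1 f2"
    and u: "u \<in> (derived_algebra br)\<^sup>\<bottom>" and v: "v \<in> (derived_algebra br)\<^sup>\<bottom>"
  defines "q \<equiv> J (f1 u) - f1 (J u) - (J (f2 (J u)) + f2 u)"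
  shows "nijenhuis br J u v = (- (J q \<bullet> v)) *\<^sub>R e1 + (- (q \<bullet> v)) *\<^sub>R e2"
proof -
  have lin: "linear J" and JJ: "\<And>x. J (J x) = - x"
    using J by (auto simp: almost_hermitian_def)
  have J\<Gamma>: "J w \<in> (derived_algebra br)\<^sup>\<bottom>" if "w \<in> (derived_algebra br)\<^sup>\<bottom>" for w
    using almost_hermitian_orthogonal_comp[OF J _ that] \<Gamma> by (simp add: type_I_def)
  have Je2: "J e2 = - e1"
    using JJ[of e1] by (simp add: e2)
  have br: "br w z = (f1 w \<bullet> z) *\<^sub>R e1 + (f2 w \<bullet> z) *\<^sub>R e2"
    if "w \<in> (derived_algebra br)\<^sup>\<bottom>" "z \<in> (derived_algebra br)\<^sup>\<bottom>" for w z
    using sd that by (simp add: structure_data_def Let_def)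
  show ?thesis
    unfolding nijenhuis_def br[OF u v] br[OF J\<Gamma>[OF u] v] br[OF u J\<Gamma>[OF v]]
      br[OF J\<Gamma>[OF u] J\<Gamma>[OF v]] q_def
    by (simp add: linear_add[OF lin] linear_diff[OF lin] linear_scale[OF lin] e2 Je2 JJ
        almost_hermitian_inner_J[OF J] inner_add_left inner_diff_left algebra_simps)
qed

theorem theorem2p5:
  fixes br :: "'a::euclidean_space \<Rightarrow> 'a \<Rightarrow> 'a"
    and J :: "'a \<Rightarrow> 'a"
    and e1 e2 a1 a2 b1 b2 :: 'a
    and f1 f2 :: "'a \<Rightarrow> 'a"
  assumes "DIM('a) \<ge> 3"
    and "lie_bracket br"
    and "dim (derived_algebra br) = 2"
    and "almost_hermitian J"
    and "type_I br J"
    and "orthonormal_basis2 (derived_algebra br) e1 e2"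
    and "J e1 = e2"
    and "structure_data br e1 e2 a1 a2 b1 b2 f1 f2"
  shows "hermitian br J \<longleftrightarrow>
    b2 - a1 = J (a2 + b1) \<and>
    (\<forall>u\<in>(derived_algebra br)\<^sup>\<bottom>. J (f1 u) - f1 (J u) = J (f2 (J u)) + f2 u)"
proof -
  let ?\<Gamma> = "(derived_algebra br)\<^sup>\<bottom>"
  let ?p = "a1 - b2 + J (a2 + b1)"
  let ?q = "\<lambda>u. J (f1 u) - f1 (J u) - (J (f2 (J u)) + f2 u)"
  note J = \<open>almost_hermitian J\<close> and I = \<open>type_I br J\<close>
    and e12 = \<open>orthonormal_basis2 (derived_algebra br) e1 e2\<close>
    and sd = \<open>structure_data br e1 e2 a1 a2 b1 b2 f1 f2\<close>
  have lin: "linear J" and JJ: "\<And>x. J (J x) = - x"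
    using J by (auto simp: almost_hermitian_def)
  have sub: "subspace ?\<Gamma>"
    by (rule subspace_orthogonal_comp)
  have J\<Gamma>: "J u \<in> ?\<Gamma>" if "u \<in> ?\<Gamma>" for u
    using almost_hermitian_orthogonal_comp[OF J _ that] I by (simp add: type_I_def)
  have f: "f1 u \<in> ?\<Gamma>" "f2 u \<in> ?\<Gamma>" if "u \<in> ?\<Gamma>" for u
    using sd that by (auto simp: structure_data_def Let_def skew_adjoint_on_def)
  \<comment> \<open>Membership in \<Gamma> allows each defect to be tested against itself
    below.\<close>
  have p: "?p \<in> ?\<Gamma>"
    using sd
    by (intro subspace_add[OF sub] subspace_diff[OF sub] J\<Gamma>)
      (simp_all add: structure_data_def Let_def)
  have q: "?q u \<in> ?\<Gamma>" if "u \<in> ?\<Gamma>" for u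
    by (intro subspace_add[OF sub] subspace_diff[OF sub] J\<Gamma> f that)
  \<comment> \<open>The negated coefficients must stay inside the scalar multiples for the criterion
    on combinations of \<open>e1, e2\<close> to match.\<close>
  have "(\<forall>u\<in>?\<Gamma>. nijenhuis br J u e1 = 0) \<longleftrightarrow> (\<forall>u\<in>?\<Gamma>. ?p \<bullet> u = 0 \<and> J ?p \<bullet> u = 0)"
    by (simp add: nijenhuis_e1[OF J I \<open>J e1 = e2\<close> sd] orthonormal_combination_eq_0_iff[OF e12]
        del: scaleR_minus_left)
  \<comment> \<open>Take \<open>u = ?p\<close> for one direction; \<open>J 0 = 0\<close> settles the
    other.\<close>
  also have "\<dots> \<longleftrightarrow> ?p = 0"
    using p linear_0[OF lin] by (metis inner_eq_zero_iff inner_zero_left)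
  also have "\<dots> \<longleftrightarrow> b2 - a1 = J (a2 + b1)"
    by (auto simp: algebra_simps)
  finally have 1: "(\<forall>u\<in>?\<Gamma>. nijenhuis br J u e1 = 0) \<longleftrightarrow> b2 - a1 = J (a2 + b1)" .
  have 2: "(\<forall>v\<in>?\<Gamma>. nijenhuis br J u v = 0) \<longleftrightarrow> J (f1 u) - f1 (J u) = J (f2 (J u)) + f2 u"
    if u: "u \<in> ?\<Gamma>" for u
  proof -
    have "(\<forall>v\<in>?\<Gamma>. nijenhuis br J u v = 0) \<longleftrightarrow> (\<forall>v\<in>?\<Gamma>. J (?q u) \<bullet> v = 0 \<and> ?q u \<bullet> v = 0)"
      by (simp add: nijenhuis_complement[OF J I \<open>J e1 = e2\<close> sd u]
          orthonormal_combination_eq_0_iff[OF e12] del: scaleR_minus_left)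
    \<comment> \<open>The same argument with \<open>v = ?q u\<close>, for each fixed
      \<open>u\<close>.\<close>
    also have "\<dots> \<longleftrightarrow> ?q u = 0"
      using q[OF u] linear_0[OF lin] by (metis inner_eq_zero_iff inner_zero_left)
    finally show ?thesis
      by simp
  qed
  show ?thesis
    using J 1 2 nijenhuis_vanishes_iff[OF \<open>lie_bracket br\<close> lin JJ e12 \<open>J e1 = e2\<close>]
    by (simp add: hermitian_def integrable_structure_def)
qed

end
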